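(* Let $x_1,\dots,x_n$ be positive real numbers, let $\mu=(\mu_1,\dots,\mu_m)$ and $\lambda=(\lambda_1,\dots,\lambda_n)$ be probability vectors, and let $\omega_1,\omega_2$ be two weight functions with respect to $\mu$ and $\lambda$. Then $$\prod_{j=1}^nx_j^{\lambda_j}\le\prod_{i=1}^m\left[I\left(\sum_{j=1}^n\omega_1(i,j)\lambda_jx_j,\ \sum_{j=1}^n\omega_2(i,j)\lambda_jx_j\right)\right]^{\mu_i}\le\sum_{j=1}^n\lambda_jx_j.$$ In particular, if $B=[b_{ij}]_{n\times n}$ and $C=[c_{ij}]_{n\times n}$ are two double stochastic matrices, then $$\sqrt[n]{x_1x_2\cdots x_n}\le\sqrt[n]{\prod_{i=1}^nI\left(\sum_{j=1}^nb_{ij}x_j,\ \sum_{j=1}^nc_{ij}x_j\right)}\le\frac{x_1+x_2+\cdots+x_n}{n}.$$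
   Context: $m,n\ge1$ are integers. Probability vectors: $\mu_i\ge0$, $\lambda_j\ge0$, $\sum_{i=1}^m\mu_i=1$, $\sum_{j=1}^n\lambda_j=1$. A weight function with respect to $\mu$ and $\lambda$ is a map $\omega:\{1,\dots,m\}\times\{1,\dots,n\}\to[0,\infty)$ such that $\sum_{i=1}^m\omega(i,j)\mu_i=1$ for every $j=1,\dots,n$ and $\sum_{j=1}^n\omega(i,j)\lambda_j=1$ for every $i=1,\dots,m$. A double stochastic matrix is a square matrix with nonnegative real entries each of whose rows and columns sums to $1$. The identric mean of $a,b>0$ is $I(a,b)=a$ if $a=b$, and $I(a,b)=\frac1e\left(\frac{b^b}{a^a}\right)^{1/(b-a)}$ if $a\ne b$. *)

theory Defs
  imports "HOL-Analysis.Analysis"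
begin

text \<open>
  The index sets $\{1,\dots,m\}$ and $\{1,\dots,n\}$ with $m, n \ge 1$ are arbitrary finite types
  \<open>'m\<close> and \<open>'n\<close>; thus $n$ is \<open>CARD('n)\<close>.
\<close>

definition probability_vector :: "real ^ 'n \<Rightarrow> bool"
  where "probability_vector p \<longleftrightarrow> (\<forall>i. 0 \<le> p $ i) \<and> (\<Sum>i\<in>UNIV. p $ i) = 1"

definition weight_function :: "real ^ 'm \<Rightarrow> real ^ 'n \<Rightarrow> ('m \<Rightarrow> 'n \<Rightarrow> real) \<Rightarrow> bool"
  where "weight_function \<mu> l \<omega> \<longleftrightarrow>
    (\<forall>i j. 0 \<le> \<omega> i j) \<and>
    (\<forall>j. (\<Sum>i\<in>UNIV. \<omega> i j * \<mu> $ i) = 1) \<and>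
    (\<forall>i. (\<Sum>j\<in>UNIV. \<omega> i j * l $ j) = 1)"

definition double_stochastic :: "real ^ 'n ^ 'n \<Rightarrow> bool"
  where "double_stochastic A \<longleftrightarrow>
    (\<forall>i j. 0 \<le> A $ i $ j) \<and>
    (\<forall>i. (\<Sum>j\<in>UNIV. A $ i $ j) = 1) \<and>
    (\<forall>j. (\<Sum>i\<in>UNIV. A $ i $ j) = 1)"

text \<open>Only meaningful for positive arguments.\<close>
definition identric_mean :: "real \<Rightarrow> real \<Rightarrow> real"
  where "identric_mean a b =
    (if a = b then a
     else 1 / exp 1 * ((b powr b) / (a powr a)) powr (1 / (b - a)))"

end

theory Submission
  imports Defs
begin

text \<open>
  The identric mean of \<open>a\<close> and \<open>b\<close> is the exponential of the average of \<open>ln\<close> over the segment from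
  \<open>a\<close> to \<open>b\<close>. As \<open>ln\<close> is concave, the Hermite--Hadamard inequality places it between the geometric
  and the arithmetic mean of \<open>a\<close> and \<open>b\<close> (\<open>ln_identric_mean_bounds\<close>).

  For the lower estimate, replace each identric mean by the geometric mean. Every row of
  \<open>\<omega> i j * l $ j\<close> is a probability vector, so Jensen's inequality for \<open>ln\<close> bounds the logarithm
  of a row average of \<open>x\<close> from below by the row average of \<open>ln x\<close>. Averaging this over \<open>i\<close> with
  the weights \<open>\<mu>\<close> turns the column condition on \<open>\<omega>\<close> into the total weight \<open>l $ j\<close> on each
  \<open>ln (x $ j)\<close>.

  For the upper estimate, replace each identric mean by the arithmetic mean and apply Jensen's
  inequality to the outer weights \<open>\<mu>\<close>; the column condition now collapses the double sum to
  \<open>\<Sum>j\<in>UNIV. l $ j * x $ j\<close>.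

  The statement on doubly stochastic matrices is the case of uniform \<open>\<mu>\<close> and \<open>l\<close>, with the matrix
  entries multiplied by \<open>CARD('n)\<close>.
\<close>

section \<open>Jensen's inequality for the logarithm\<close>

lemma weighted_sum_pos:
  fixes w y :: "'a \<Rightarrow> real"
  assumes "finite A" "\<And>j. j \<in> A \<Longrightarrow> 0 \<le> w j" "sum w A = 1" "\<And>j. j \<in> A \<Longrightarrow> 0 < y j"
  shows "0 < (\<Sum>j\<in>A. w j * y j)"
proof -
  obtain k where k: "k \<in> A" "w k \<noteq> 0"
    using assms(3) by (metis sum.neutral zero_neq_one)
  have "0 < w k * y k"
    using assms(2)[OF k(1)] assms(4)[OF k(1)] k(2) by simp
  then show ?thesis
    using assms k(1) by (intro sum_pos2[of A k]) (auto intro: mult_nonneg_nonneg less_imp_le)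
qed

text \<open>
  Jensen's inequality for \<open>ln\<close>, which follows by averaging the tangent line estimate
  \<open>ln y \<le> ln c + (y - c) / c\<close> at the weighted mean \<open>c\<close>, where the linear term averages to zero.
\<close>
lemma weighted_sum_ln_le:
  fixes w y :: "'a \<Rightarrow> real"
  assumes "finite A" "\<And>j. j \<in> A \<Longrightarrow> 0 \<le> w j" "sum w A = 1" "\<And>j. j \<in> A \<Longrightarrow> 0 < y j"
  shows "(\<Sum>j\<in>A. w j * ln (y j)) \<le> ln (\<Sum>j\<in>A. w j * y j)"
proof -
  define c where "c = (\<Sum>j\<in>A. w j * y j)"
  have c: "0 < c"
    unfolding c_def using assms by (rule weighted_sum_pos)
  have tangent: "ln (y j) \<le> (ln c - 1) + y j / c" if "j \<in> A" for j
    using ln_le_minus_one[of "y j / c"] assms(4)[OF that] c by (simp add: ln_div)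
  have "(\<Sum>j\<in>A. w j * ln (y j)) \<le> (\<Sum>j\<in>A. w j * ((ln c - 1) + y j / c))"
    using tangent assms(2) by (intro sum_mono mult_left_mono)
  also have "\<dots> = (ln c - 1) * sum w A + (\<Sum>j\<in>A. w j * y j) / c"
    by (simp add: distrib_left sum.distrib sum_distrib_left sum_distrib_right sum_divide_distrib mult.commute)
  also have "\<dots> = ln c"
    using c assms(3) unfolding c_def[symmetric] by simp
  finally show ?thesis
    unfolding c_def .
qed

section \<open>The identric mean between the geometric and the arithmetic mean\<close>

text \<open>
  The Hermite--Hadamard inequality for \<open>ln\<close> on an interval scaled to \<open>[1 - s, 1 + s]\<close>. Both
  differences vanish at \<open>s = 0\<close>; their derivatives in \<open>s\<close> are \<open>2 / (1 - s\<^sup>2) - 2\<close> and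
  \<open>- ln (1 - s\<^sup>2)\<close>, which are nonnegative.
\<close>
lemma hermite_hadamard_ln_symmetric:
  fixes s :: real
  assumes "0 \<le> s" "s < 1"
  shows "2 * s \<le> ln (1 + s) - ln (1 - s)"
    and "(1 + s) * ln (1 + s) - (1 - s) * ln (1 - s) \<le> 2 * s"
proof -
  define f :: "real \<Rightarrow> real" where "f t = ln (1 + t) - ln (1 - t) - 2 * t" for t
  define g :: "real \<Rightarrow> real"
    where "g t = 2 * t - ((1 + t) * ln (1 + t) - (1 - t) * ln (1 - t))" for t
  have "f 0 \<le> f s"
  proof (rule DERIV_nonneg_imp_nondecreasing[OF assms(1)])
    fix t assume t: "0 \<le> t" "t \<le> s"
    have "(f has_real_derivative 1 / (1 + t) + 1 / (1 - t) - 2) (at t)"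
      unfolding f_def using t assms by (auto intro!: derivative_eq_intros)
    moreover have "1 / (1 + t) + 1 / (1 - t) - 2 = 2 * t\<^sup>2 / ((1 + t) * (1 - t))"
      using t assms by (simp add: divide_simps power2_eq_square) (simp add: algebra_simps)
    moreover have "0 \<le> 2 * t\<^sup>2 / ((1 + t) * (1 - t))"
      using t assms by simp
    ultimately show "\<exists>y. (f has_real_derivative y) (at t) \<and> 0 \<le> y"
      by auto
  qed
  then show "2 * s \<le> ln (1 + s) - ln (1 - s)"
    by (simp add: f_def)
  have "g 0 \<le> g s"
  proof (rule DERIV_nonneg_imp_nondecreasing[OF assms(1)])
    fix t assume t: "0 \<le> t" "t \<le> s"
    have "(g has_real_derivative - (ln (1 + t) + ln (1 - t))) (at t)"
      unfolding g_def using t assms by (auto intro!: derivative_eq_intros)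
    moreover have "ln (1 + t) + ln (1 - t) \<le> 0"
      using ln_le_minus_one[of "1 + t"] ln_le_minus_one[of "1 - t"] t assms by simp
    ultimately show "\<exists>y. (g has_real_derivative y) (at t) \<and> 0 \<le> y"
      by auto
  qed
  then show "(1 + s) * ln (1 + s) - (1 - s) * ln (1 - s) \<le> 2 * s"
    by (simp add: g_def)
qed

lemma identric_mean_pos:
  assumes "0 < a" "0 < b"
  shows "0 < identric_mean a b"
  using assms by (simp add: identric_mean_def)

lemma ln_identric_mean:
  assumes "0 < a" "0 < b" "a \<noteq> b"
  shows "ln (identric_mean a b) = (b * ln b - a * ln a) / (b - a) - 1"
  using assms by (simp add: identric_mean_def ln_mult ln_div ln_powr)

text \<open>
  The identric mean lies between the geometric and the arithmetic mean. With \<open>m\<close> the midpoint,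
  writing \<open>a = m * (1 - s)\<close> and \<open>b = m * (1 + s)\<close> makes the terms in \<open>ln m\<close> cancel and leaves
  the inequality on the symmetric interval.
\<close>
lemma ln_identric_mean_bounds:
  assumes "0 < a" "0 < b"
  shows "(ln a + ln b) / 2 \<le> ln (identric_mean a b)"
    and "ln (identric_mean a b) \<le> ln ((a + b) / 2)"
proof -
  have ordered: "(ln a + ln b) / 2 \<le> (b * ln b - a * ln a) / (b - a) - 1 \<and>
      (b * ln b - a * ln a) / (b - a) - 1 \<le> ln ((a + b) / 2)"
    if "0 < a" "a < b" for a b :: real
  proof -
    define m s where "m = (a + b) / 2" and "s = (b - a) / (a + b)"
    have m: "0 < m" and s: "0 < s" "s < 1"
      using that by (auto simp: m_def s_def)
    have ab: "a = m * (1 - s)" "b = m * (1 + s)"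
      using that by (auto simp: m_def s_def field_simps)
    have lna: "ln a = ln m + ln (1 - s)" and lnb: "ln b = ln m + ln (1 + s)"
      using m s by (auto simp: ab ln_mult)
    have diff: "b - a = m * (2 * s)"
      by (simp add: ab algebra_simps)
    have "b * ln b - a * ln a = m * (2 * s * ln m + ((1 + s) * ln (1 + s) - (1 - s) * ln (1 - s)))"
      unfolding lna lnb by (simp add: ab algebra_simps)
    then have quot: "(b * ln b - a * ln a) / (b - a) =
        ln m + ((1 + s) * ln (1 + s) - (1 - s) * ln (1 - s)) / (2 * s)"
      unfolding diff using m s by (simp add: add_divide_distrib)
    have split: "((1 + s) * ln (1 + s) - (1 - s) * ln (1 - s)) / (2 * s) =
        (ln (1 + s) + ln (1 - s)) / 2 + (ln (1 + s) - ln (1 - s)) / (2 * s)"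
      using s by (simp add: field_simps)
    have "1 \<le> (ln (1 + s) - ln (1 - s)) / (2 * s)"
      using hermite_hadamard_ln_symmetric(1)[of s] s by (simp add: pos_le_divide_eq)
    then have lower: "(ln a + ln b) / 2 \<le> (b * ln b - a * ln a) / (b - a) - 1"
      unfolding quot split unfolding lna lnb by argo
    have "((1 + s) * ln (1 + s) - (1 - s) * ln (1 - s)) / (2 * s) \<le> 1"
      using hermite_hadamard_ln_symmetric(2)[of s] s by (simp add: pos_divide_le_eq)
    then have "(b * ln b - a * ln a) / (b - a) - 1 \<le> ln ((a + b) / 2)"
      unfolding quot m_def[symmetric] by simp
    with lower show ?thesis ..
  qed
  have swap: "(b * ln b - a * ln a) / (b - a) = (a * ln a - b * ln b) / (a - b)"
    by (metis minus_diff_eq minus_divide_divide)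
  have "(ln a + ln b) / 2 \<le> ln (identric_mean a b) \<and> ln (identric_mean a b) \<le> ln ((a + b) / 2)"
  proof (cases a b rule: linorder_cases)
    case less
    then show ?thesis
      using ordered[of a b] assms by (simp add: ln_identric_mean)
  next
    case equal
    then show ?thesis
      by (simp add: identric_mean_def)
  next
    case greater
    then show ?thesis
      using ordered[of b a] assms swap by (simp add: ln_identric_mean add.commute)
  qed
  then show "(ln a + ln b) / 2 \<le> ln (identric_mean a b)"
    and "ln (identric_mean a b) \<le> ln ((a + b) / 2)"
    by blast+
qed

section \<open>Averages with respect to weight functions\<close>

lemma ln_prod_powr:
  fixes y w :: "'a \<Rightarrow> real"
  assumes "finite A" "\<And>j. j \<in> A \<Longrightarrow> 0 < y j"
  shows "ln (\<Prod>j\<in>A. y j powr w j) = (\<Sum>j\<in>A. w j * ln (y j))"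
proof -
  have "y j powr w j \<noteq> 0" if "j \<in> A" for j
    using assms(2)[OF that] by simp
  with assms(1) show ?thesis
    by (simp add: ln_prod)
qed

lemma weight_function_row_pos:
  fixes \<mu> :: "real ^ 'm" and l x :: "real ^ 'n"
  assumes "weight_function \<mu> l \<omega>" "probability_vector l" "\<forall>j. 0 < x $ j"
  shows "0 < (\<Sum>j\<in>UNIV. \<omega> i j * l $ j * x $ j)"
  using assms unfolding weight_function_def probability_vector_def
  by (intro weighted_sum_pos) auto

text \<open>Exchanging the sums brings the column condition of the weight function into play.\<close>
lemma weight_function_sum_exchange:
  fixes \<mu> :: "real ^ 'm" and l :: "real ^ 'n"
  assumes "weight_function \<mu> l \<omega>"
  shows "(\<Sum>i\<in>UNIV. \<mu> $ i * (\<Sum>j\<in>UNIV. \<omega> i j * l $ j * y j)) = (\<Sum>j\<in>UNIV. l $ j * y j)"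
proof -
  have "(\<Sum>i\<in>UNIV. \<mu> $ i * (\<Sum>j\<in>UNIV. \<omega> i j * l $ j * y j)) =
      (\<Sum>j\<in>UNIV. \<Sum>i\<in>UNIV. (\<omega> i j * \<mu> $ i) * (l $ j * y j))"
    by (subst sum.swap) (simp add: sum_distrib_left mult.assoc mult.left_commute)
  also have "\<dots> = (\<Sum>j\<in>UNIV. (\<Sum>i\<in>UNIV. \<omega> i j * \<mu> $ i) * (l $ j * y j))"
    by (simp add: sum_distrib_right)
  also have "\<dots> = (\<Sum>j\<in>UNIV. l $ j * y j)"
    using assms by (simp add: weight_function_def)
  finally show ?thesis .
qed

text \<open>
  Averaging over \<open>i\<close> what Jensen's inequality gives for each row. The weighted geometric mean of \<open>x\<close>
  thus lies below that of the row averages.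
\<close>
lemma weight_function_ln_le:
  fixes \<mu> :: "real ^ 'm" and l x :: "real ^ 'n"
  assumes "weight_function \<mu> l \<omega>" "probability_vector \<mu>" "probability_vector l" "\<forall>j. 0 < x $ j"
  shows "(\<Sum>j\<in>UNIV. l $ j * ln (x $ j))
    \<le> (\<Sum>i\<in>UNIV. \<mu> $ i * ln (\<Sum>j\<in>UNIV. \<omega> i j * l $ j * x $ j))"
proof -
  have row: "(\<Sum>j\<in>UNIV. \<omega> i j * l $ j * ln (x $ j)) \<le> ln (\<Sum>j\<in>UNIV. \<omega> i j * l $ j * x $ j)" for i
    using assms unfolding weight_function_def probability_vector_def
    by (intro weighted_sum_ln_le) auto
  have "(\<Sum>i\<in>UNIV. \<mu> $ i * (\<Sum>j\<in>UNIV. \<omega> i j * l $ j * ln (x $ j)))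
      \<le> (\<Sum>i\<in>UNIV. \<mu> $ i * ln (\<Sum>j\<in>UNIV. \<omega> i j * l $ j * x $ j))"
    using row assms(2) by (intro sum_mono mult_left_mono) (auto simp: probability_vector_def)
  then show ?thesis
    using weight_function_sum_exchange[OF assms(1), of "\<lambda>j. ln (x $ j)"] by simp
qed

lemma prod_identric_mean_bounds:
  fixes \<mu> :: "real ^ 'm" and l x :: "real ^ 'n"
  assumes x: "\<forall>j. 0 < x $ j"
    and \<mu>: "probability_vector \<mu>" and l: "probability_vector l"
    and w1: "weight_function \<mu> l \<omega>1" and w2: "weight_function \<mu> l \<omega>2"
  defines "P \<equiv> \<Prod>i\<in>UNIV. identric_mean (\<Sum>j\<in>UNIV. \<omega>1 i j * l $ j * x $ j)
                                    (\<Sum>j\<in>UNIV. \<omega>2 i j * l $ j * x $ j) powr \<mu> $ i"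
  shows "(\<Prod>j\<in>UNIV. x $ j powr l $ j) \<le> P" and "P \<le> (\<Sum>j\<in>UNIV. l $ j * x $ j)"
proof -
  define a b where "a i = (\<Sum>j\<in>UNIV. \<omega>1 i j * l $ j * x $ j)"
    and "b i = (\<Sum>j\<in>UNIV. \<omega>2 i j * l $ j * x $ j)" for i
  have a: "0 < a i" and b: "0 < b i" for i
    unfolding a_def b_def using weight_function_row_pos w1 w2 l x by blast+
  have I: "0 < identric_mean (a i) (b i)" for i
    using a b by (rule identric_mean_pos)
  have \<mu>0: "0 \<le> \<mu> $ i" for i
    using \<mu> by (simp add: probability_vector_def)
  have P: "P = (\<Prod>i\<in>UNIV. identric_mean (a i) (b i) powr \<mu> $ i)"
    by (simp add: P_def a_def b_def)
  have Ppos: "0 < P"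
    unfolding P using I by (intro prod_pos) (simp add: less_imp_neq[symmetric])
  have lnP: "ln P = (\<Sum>i\<in>UNIV. \<mu> $ i * ln (identric_mean (a i) (b i)))"
    unfolding P using I by (intro ln_prod_powr) auto
  have "(\<Sum>j\<in>UNIV. l $ j * ln (x $ j))
      \<le> ((\<Sum>i\<in>UNIV. \<mu> $ i * ln (a i)) + (\<Sum>i\<in>UNIV. \<mu> $ i * ln (b i))) / 2"
    using weight_function_ln_le[OF w1 \<mu> l x, folded a_def]
      weight_function_ln_le[OF w2 \<mu> l x, folded b_def] by argo
  also have "\<dots> = (\<Sum>i\<in>UNIV. \<mu> $ i * ((ln (a i) + ln (b i)) / 2))"
    by (simp add: distrib_left add_divide_distrib sum.distrib sum_divide_distrib)
  also have "\<dots> \<le> ln P"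
    unfolding lnP using ln_identric_mean_bounds(1)[OF a b] \<mu>0
    by (intro sum_mono mult_left_mono)
  finally have "ln (\<Prod>j\<in>UNIV. x $ j powr l $ j) \<le> ln P"
    using x by (simp add: ln_prod_powr)
  moreover have "0 < (\<Prod>j\<in>UNIV. x $ j powr l $ j)"
    using x by (intro prod_pos) (simp add: less_imp_neq[symmetric])
  ultimately show "(\<Prod>j\<in>UNIV. x $ j powr l $ j) \<le> P"
    using Ppos by simp
  have "ln P \<le> (\<Sum>i\<in>UNIV. \<mu> $ i * ln ((a i + b i) / 2))"
    unfolding lnP using ln_identric_mean_bounds(2)[OF a b] \<mu>0
    by (intro sum_mono mult_left_mono)
  also have "\<dots> \<le> ln (\<Sum>i\<in>UNIV. \<mu> $ i * ((a i + b i) / 2))"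
    using \<mu> a b unfolding probability_vector_def
    by (intro weighted_sum_ln_le) (auto simp: add_pos_pos)
  also have "(\<Sum>i\<in>UNIV. \<mu> $ i * ((a i + b i) / 2)) =
      ((\<Sum>i\<in>UNIV. \<mu> $ i * a i) + (\<Sum>i\<in>UNIV. \<mu> $ i * b i)) / 2"
    by (simp add: distrib_left add_divide_distrib sum.distrib sum_divide_distrib)
  also have "\<dots> = (\<Sum>j\<in>UNIV. l $ j * x $ j)"
    unfolding a_def b_def
    by (simp add: weight_function_sum_exchange[OF w1] weight_function_sum_exchange[OF w2])
  finally have "ln P \<le> ln (\<Sum>j\<in>UNIV. l $ j * x $ j)" .
  moreover have "0 < (\<Sum>j\<in>UNIV. l $ j * x $ j)"
    using l x unfolding probability_vector_def by (intro weighted_sum_pos) auto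
  ultimately show "P \<le> (\<Sum>j\<in>UNIV. l $ j * x $ j)"
    using Ppos by simp
qed

section \<open>Doubly stochastic matrices\<close>

lemma root_prod_eq_prod_powr:
  fixes y :: "'a \<Rightarrow> real"
  assumes "0 < k" "\<And>i. i \<in> A \<Longrightarrow> 0 < y i"
  shows "root k (\<Prod>i\<in>A. y i) = (\<Prod>i\<in>A. y i powr (1 / real k))"
  using assms by (simp add: root_powr_inverse prod_pos prod_powr_distrib less_imp_le)

text \<open>
  The uniform weight vector has entries \<open>1 / CARD('n)\<close>, so the scaling by \<open>CARD('n)\<close> makes the
  products of weights in the row and column conditions equal to the matrix entries.
\<close>
lemma weight_function_of_double_stochastic:
  fixes A :: "real ^ 'n ^ 'n"
  assumes "double_stochastic A"
  shows "weight_function (\<chi> i. 1 / real CARD('n)) (\<chi> i. 1 / real CARD('n))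
    (\<lambda>i j. real CARD('n) * A $ i $ j)"
  using assms by (simp add: weight_function_def double_stochastic_def)

lemma root_prod_identric_mean_bounds:
  fixes x :: "real ^ 'n" and B C :: "real ^ 'n ^ 'n"
  assumes x: "\<forall>j. 0 < x $ j" and B: "double_stochastic B" and C: "double_stochastic C"
  defines "R \<equiv> root CARD('n) (\<Prod>i\<in>UNIV. identric_mean (\<Sum>j\<in>UNIV. B $ i $ j * x $ j)
                                                 (\<Sum>j\<in>UNIV. C $ i $ j * x $ j))"
  shows "root CARD('n) (\<Prod>j\<in>UNIV. x $ j) \<le> R"
    and "R \<le> (\<Sum>j\<in>UNIV. x $ j) / real CARD('n)"
proof -
  define u :: "real ^ 'n" where "u = (\<chi> i. 1 / real CARD('n))"
  have u: "probability_vector u"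
    by (simp add: probability_vector_def u_def)
  note weights = weight_function_of_double_stochastic[OF B, folded u_def]
    weight_function_of_double_stochastic[OF C, folded u_def]
  note bounds = prod_identric_mean_bounds[OF x u u weights]
  have row: "0 < (\<Sum>j\<in>UNIV. A $ i $ j * x $ j)" if "double_stochastic A"
    for A :: "real ^ 'n ^ 'n" and i
    using that x unfolding double_stochastic_def by (intro weighted_sum_pos) auto
  have R: "R = (\<Prod>i\<in>UNIV. identric_mean (\<Sum>j\<in>UNIV. B $ i $ j * x $ j)
      (\<Sum>j\<in>UNIV. C $ i $ j * x $ j) powr (1 / real CARD('n)))"
    unfolding R_def using row B C
    by (intro root_prod_eq_prod_powr identric_mean_pos) auto
  have "root CARD('n) (\<Prod>j\<in>UNIV. x $ j) = (\<Prod>j\<in>UNIV. x $ j powr (1 / real CARD('n)))"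
    using x by (intro root_prod_eq_prod_powr) auto
  then show "root CARD('n) (\<Prod>j\<in>UNIV. x $ j) \<le> R"
    using bounds(1) unfolding R by (simp add: u_def)
  show "R \<le> (\<Sum>j\<in>UNIV. x $ j) / real CARD('n)"
    using bounds(2) unfolding R by (simp add: u_def sum_divide_distrib)
qed

section \<open>Refinement of the arithmetic-geometric mean inequality by identric means\<close>

theorem theorem3p1:
  fixes x :: "real ^ 'n"
  assumes "\<forall>j. 0 < x $ j"
  shows "(\<forall>(\<mu> :: real ^ 'm) (l :: real ^ 'n) \<omega>1 \<omega>2.
            probability_vector \<mu> \<and> probability_vector l \<and>
            weight_function \<mu> l \<omega>1 \<and> weight_function \<mu> l \<omega>2 \<longrightarrow>
            (\<Prod>j\<in>UNIV. x $ j powr l $ j)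
              \<le> (\<Prod>i\<in>UNIV. identric_mean (\<Sum>j\<in>UNIV. \<omega>1 i j * l $ j * x $ j)
                                       (\<Sum>j\<in>UNIV. \<omega>2 i j * l $ j * x $ j) powr \<mu> $ i) \<and>
            (\<Prod>i\<in>UNIV. identric_mean (\<Sum>j\<in>UNIV. \<omega>1 i j * l $ j * x $ j)
                                     (\<Sum>j\<in>UNIV. \<omega>2 i j * l $ j * x $ j) powr \<mu> $ i)
              \<le> (\<Sum>j\<in>UNIV. l $ j * x $ j)) \<and>
         (\<forall>B C :: real ^ 'n ^ 'n.
            double_stochastic B \<and> double_stochastic C \<longrightarrow>
            root CARD('n) (\<Prod>j\<in>UNIV. x $ j)
              \<le> root CARD('n) (\<Prod>i\<in>UNIV. identric_mean (\<Sum>j\<in>UNIV. B $ i $ j * x $ j)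
                                                    (\<Sum>j\<in>UNIV. C $ i $ j * x $ j)) \<and>
            root CARD('n) (\<Prod>i\<in>UNIV. identric_mean (\<Sum>j\<in>UNIV. B $ i $ j * x $ j)
                                                  (\<Sum>j\<in>UNIV. C $ i $ j * x $ j))
              \<le> (\<Sum>j\<in>UNIV. x $ j) / real CARD('n))"
  using prod_identric_mean_bounds[OF assms] root_prod_identric_mean_bounds[OF assms] by blast

end
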